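(* Let $\pi\in S_4\setminus\{2143,2413,3142,3412\}$ and let $p=(\pi,R)$ with $R=(\{0,4\}\times[4])\cup([4]\times\{0,4\})$ (exactly the boundary boxes shaded). Then \[ \lim_{n\to\infty}\frac{s_n^+(p)}{n!}=0. \]
   Context: For $n\ge1$, $S_n$ is the set of permutations of $\{1,\dots,n\}$ in one-line notation $\tau=\tau_1\cdots\tau_n$. For an integer $k\ge0$ write $[k]=\{0,1,\dots,k\}$. A mesh pattern of length $k$ is a pair $(\pi,R)$ with $\pi\in S_k$ and $R\subseteq[k]\times[k]$; the elements $(x,y)\in R$ are the shaded boxes (box $(x,y)$ is the unit square with south-west corner $(x,y)$ in the plot of the points $(i,\pi_i)$). An occurrence of $(\pi,R)$ in $\tau\in S_n$ is a choice of positions $i_1<\dots<i_k$ such that $\tau_{i_a}<\tau_{i_b}$ iff $\pi_a<\pi_b$ for all $a,b$, and such that for every $(x,y)\in R$ there is no index $m$ with $i_x<m<i_{x+1}$ and $v_y<\tau_m<v_{y+1}$, where $i_0=0$, $i_{k+1}=n+1$, $v_0=0$, $v_{k+1}=n+1$, and for $1\le y\le k$, $v_y$ is the $y$-th smallest of the values $\tau_{i_1},\dots,\tau_{i_k}$. A permutation contains a mesh pattern if it has at least one occurrence of it, and $s_n^+(p)$ denotes the number of permutations in $S_n$ containing $p$. *)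

theory Defs
  imports Complex_Main "HOL-Combinatorics.Multiset_Permutations"
begin

text \<open>
  Permutations are given in one-line notation, as lists. Positions are counted from 1, as are
  the values, so \<open>entry \<tau> i\<close> is the letter $\tau_i$.
\<close>

definition perms :: "nat \<Rightarrow> nat list set" where
  "perms n = permutations_of_set {1..n}"

definition entry :: "nat list \<Rightarrow> nat \<Rightarrow> nat" where
  "entry \<tau> i = \<tau> ! (i - 1)"

text \<open>A pair \<open>(\<pi>, R)\<close>: the underlying permutation and the set of shaded boxes. The type
  does not enforce the side conditions, which are stated in \<open>is_mesh_pattern\<close>.\<close>

type_synonym mesh_pattern = "nat list \<times> (nat \<times> nat) set"

definition is_mesh_pattern :: "nat \<Rightarrow> mesh_pattern \<Rightarrow> bool" where
  "is_mesh_pattern k p \<longleftrightarrow> fst p \<in> perms k \<and> snd p \<subseteq> {0..k} \<times> {0..k}"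

lemma is_mesh_pattern_boundary:
  assumes "\<pi> \<in> perms k"
  shows "is_mesh_pattern k (\<pi>, ({0,k} \<times> {0..k}) \<union> ({0..k} \<times> {0,k}))"
  using assms by (auto simp: is_mesh_pattern_def)

text \<open>
  An occurrence is given by the list \<open>ps\<close> of its positions $i_1 < \dots < i_k$. Padding this list
  and the sorted list of the values at these positions with \<open>0\<close> and \<open>n + 1\<close> yields
  $i_0, \dots, i_{k+1}$ and $v_0, \dots, v_{k+1}$, with matching list indices.
\<close>

definition occ_pos :: "nat list \<Rightarrow> nat list \<Rightarrow> nat \<Rightarrow> nat" where
  "occ_pos \<tau> ps x = (0 # ps @ [length \<tau> + 1]) ! x"

definition occ_val :: "nat list \<Rightarrow> nat list \<Rightarrow> nat \<Rightarrow> nat" where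
  "occ_val \<tau> ps y = (0 # sort (map (entry \<tau>) ps) @ [length \<tau> + 1]) ! y"

definition is_occurrence :: "mesh_pattern \<Rightarrow> nat list \<Rightarrow> nat list \<Rightarrow> bool" where
  "is_occurrence p \<tau> ps \<longleftrightarrow>
     (let \<pi> = fst p; R = snd p; k = length \<pi>; n = length \<tau> in
        length ps = k \<and> sorted_wrt (<) ps \<and> set ps \<subseteq> {1..n} \<and>
        (\<forall>a\<in>{1..k}. \<forall>b\<in>{1..k}.
           entry \<tau> (occ_pos \<tau> ps a) < entry \<tau> (occ_pos \<tau> ps b) \<longleftrightarrow> entry \<pi> a < entry \<pi> b) \<and>
        (\<forall>(x, y)\<in>R. \<not> (\<exists>m\<in>{1..n}.
           occ_pos \<tau> ps x < m \<and> m < occ_pos \<tau> ps (x + 1) \<and>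
           occ_val \<tau> ps y < entry \<tau> m \<and> entry \<tau> m < occ_val \<tau> ps (y + 1))))"

definition contains_mesh :: "nat list \<Rightarrow> mesh_pattern \<Rightarrow> bool" where
  "contains_mesh \<tau> p \<longleftrightarrow> (\<exists>ps. is_occurrence p \<tau> ps)"

definition s_plus :: "nat \<Rightarrow> mesh_pattern \<Rightarrow> nat" where
  "s_plus n p = card {\<tau> \<in> perms n. contains_mesh \<tau> p}"

end

theory Submission
  imports Defs
begin

text \<open>
  Since all boundary boxes are shaded, an occurrence must use the first and the last position as
  well as the smallest and the largest value. If \<open>\<pi>\<close> is not one of the four excluded
  permutations, then its first or its last letter is \<open>1\<close> or \<open>4\<close>, so that the first or the last
  letter of \<open>\<tau>\<close> is \<open>1\<close> or \<open>n\<close>; this holds for at most \<open>4 * fact (n - 1)\<close> permutations.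
\<close>

text \<open>Locates a point in the grid cut out by an occurrence: with \<open>xs\<close> the
  positions or the sorted values of the occurrence, \<open>y\<close> is the column or the row of a
  point outside it. The padding by \<open>a\<close> and \<open>b\<close> follows
  \<open>occ_pos\<close> and \<open>occ_val\<close>, so \<open>y\<close> is directly a box
  coordinate.\<close>

lemma sorted_list_gap:
  fixes e :: "'a :: linorder"
  assumes "sorted xs" "a < e" "e < b" "e \<notin> set xs"
  obtains y where "y \<le> length xs" "(a # xs @ [b]) ! y < e" "e < (a # xs @ [b]) ! Suc y"
  using assms
proof (induction xs arbitrary: a thesis)
  case Nil
  then show ?case by (metis append_Nil le_numeral_extra(3) list.size(3) nth_Cons_0 nth_Cons_Suc)
next
  case (Cons x xs)
  show ?case
  proof (cases "e < x")
    case True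
    with Cons.prems show ?thesis by (intro Cons.prems(1)[of 0]) auto
  next
    case False
    \<comment> \<open>The head \<open>x\<close> takes over the role of the left endpoint
      \<open>a\<close>, and the index found in the tail shifts by one.\<close>
    with Cons.prems have "x < e" by auto
    with Cons.prems obtain y where
      "y \<le> length xs" "(x # xs @ [b]) ! y < e" "e < (x # xs @ [b]) ! Suc y"
      using Cons.IH[of x] by auto
    then show ?thesis by (intro Cons.prems(1)[of "Suc y"]) auto
  qed
qed

section \<open>Permutations in one-line notation and their number with one prescribed letter\<close>

lemma perms_length: "\<tau> \<in> perms n \<Longrightarrow> length \<tau> = n"
  by (auto simp: perms_def length_finite_permutations_of_set)

lemma perms_entry_range:
  assumes "\<tau> \<in> perms n" "m \<in> {1..n}" shows "entry \<tau> m \<in> {1..n}"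
proof -
  have "entry \<tau> m \<in> set \<tau>"
    using perms_length[OF assms(1)] assms(2) by (auto simp: entry_def)
  then show ?thesis using assms(1) by (metis perms_def permutations_of_setD(1))
qed

lemma perms_entry_inj:
  assumes "\<tau> \<in> perms n" shows "inj_on (entry \<tau>) {1..n}"
proof (rule inj_onI)
  fix i j assume "i \<in> {1..n}" "j \<in> {1..n}" "entry \<tau> i = entry \<tau> j"
  with assms perms_length[OF assms] show "i = j"
    by (auto simp: perms_def entry_def nth_eq_iff_index_eq dest!: permutations_of_setD)
qed

lemma perms_entry_surj:
  assumes "\<tau> \<in> perms n" "v \<in> {1..n}"
  obtains m where "m \<in> {1..n}" "entry \<tau> m = v"
proof -
  have "v \<in> set \<tau>" using assms by (auto simp: perms_def dest: permutations_of_setD)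
  then obtain i where "i < n" "\<tau> ! i = v"
    using perms_length[OF assms(1)] by (auto simp: in_set_conv_nth)
  then show ?thesis by (intro that[of "Suc i"]) (auto simp: entry_def)
qed

text \<open>Deleting the letter \<open>v\<close> at position \<open>m\<close> leaves an arrangement
  of the other \<open>n - 1\<close> values, and reinserting \<open>v\<close> there recovers the
  permutation. So the set is covered by the image of \<open>?B\<close> under the insertion map
  \<open>?f\<close>.\<close>

lemma card_perms_fixed_entry:
  assumes "m \<in> {1..n}" "v \<in> {1..n}"
  shows "card {\<tau> \<in> perms n. entry \<tau> m = v} \<le> fact (n - 1)"
proof -
  let ?B = "permutations_of_set ({1..n} - {v})"
  let ?f = "\<lambda>r. take (m - 1) r @ v # drop (m - 1) r"
  have "{\<tau> \<in> perms n. entry \<tau> m = v} \<subseteq> ?f ` ?B"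
  proof safe
    fix \<tau> assume t: "\<tau> \<in> perms n" and v: "v = entry \<tau> m"
    have len: "m - 1 < length \<tau>" using perms_length[OF t] assms by auto
    \<comment> \<open>\<open>?r\<close> is \<open>\<tau>\<close> without its letter at position
      \<open>m\<close>; as positions count from 1, exactly \<open>m - 1\<close> letters precede
      it.\<close>
    let ?r = "take (m - 1) \<tau> @ drop m \<tau>"
    have split: "\<tau> = take (m - 1) \<tau> @ v # drop m \<tau>"
      using id_take_nth_drop[OF len] assms(1) v by (simp add: entry_def)
    have d: "distinct \<tau>" "set \<tau> = {1..n}"
      using t by (auto simp: perms_def dest: permutations_of_setD)
    have "distinct (take (m - 1) \<tau> @ v # drop m \<tau>)"
      "set (take (m - 1) \<tau> @ v # drop m \<tau>) = {1..n}"
      using d split by metis+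
    then have "distinct ?r" "set ?r = {1..n} - {v}" by auto
    then have "?r \<in> ?B" by (intro permutations_of_setI)
    moreover have "?f ?r = \<tau>" using len split by (simp add: min_def)
    ultimately show "\<tau> \<in> (\<lambda>r. take (m - 1) r @ entry \<tau> m # drop (m - 1) r)
        ` permutations_of_set ({1..n} - {entry \<tau> m})"
      using v by (metis (no_types, lifting) image_eqI)
  qed
  then have "card {\<tau> \<in> perms n. entry \<tau> m = v} \<le> card ?B"
    by (intro surj_card_le) auto
  also have "card ?B = fact (n - 1)" using assms by simp
  finally show ?thesis .
qed

text \<open>Unfolds the definition once, with the order condition moved to list indices counted from
  0: the position \<open>ps ! a\<close> plays the letter of \<open>\<pi>\<close> at position
  \<open>Suc a\<close>.\<close>

lemma is_occurrenceD:
  assumes "is_occurrence (\<pi>, R) \<tau> ps" "length \<pi> = k" "length \<tau> = n"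
  shows "length ps = k" "sorted_wrt (<) ps" "set ps \<subseteq> {1..n}"
    and "\<And>a b. a < k \<Longrightarrow> b < k \<Longrightarrow>
      entry \<tau> (ps ! a) < entry \<tau> (ps ! b) \<longleftrightarrow> entry \<pi> (Suc a) < entry \<pi> (Suc b)"
    and "\<And>x y m. (x, y) \<in> R \<Longrightarrow> m \<in> {1..n} \<Longrightarrow>
      occ_pos \<tau> ps x < m \<Longrightarrow> m < occ_pos \<tau> ps (Suc x) \<Longrightarrow>
      occ_val \<tau> ps y < entry \<tau> m \<Longrightarrow> entry \<tau> m < occ_val \<tau> ps (Suc y) \<Longrightarrow> False"
proof -
  show l: "length ps = k" and "sorted_wrt (<) ps" "set ps \<subseteq> {1..n}"
    using assms by (auto simp: is_occurrence_def Let_def)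
  show "entry \<tau> (ps ! a) < entry \<tau> (ps ! b) \<longleftrightarrow> entry \<pi> (Suc a) < entry \<pi> (Suc b)"
    if "a < k" "b < k" for a b
  proof -
    have "\<forall>a\<in>{1..k}. \<forall>b\<in>{1..k}.
        entry \<tau> (occ_pos \<tau> ps a) < entry \<tau> (occ_pos \<tau> ps b) \<longleftrightarrow> entry \<pi> a < entry \<pi> b"
      using assms by (auto simp: is_occurrence_def Let_def)
    then have "entry \<tau> (occ_pos \<tau> ps (Suc a)) < entry \<tau> (occ_pos \<tau> ps (Suc b))
        \<longleftrightarrow> entry \<pi> (Suc a) < entry \<pi> (Suc b)"
      using that by simp
    then show ?thesis using that l by (simp add: occ_pos_def nth_append)
  qed
  show False if "(x, y) \<in> R" "m \<in> {1..n}" "occ_pos \<tau> ps x < m" "m < occ_pos \<tau> ps (Suc x)"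
      "occ_val \<tau> ps y < entry \<tau> m" "entry \<tau> m < occ_val \<tau> ps (Suc y)" for x y m
    using assms that by (fastforce simp: is_occurrence_def Let_def)
qed

section \<open>Occurrences of a pattern of length \<open>k\<close> with all boundary boxes
  shaded\<close>

context
  fixes \<pi> \<tau> ps :: "nat list" and k n :: nat
  assumes \<pi>: "\<pi> \<in> perms k" and \<tau>: "\<tau> \<in> perms n" and k: "0 < k"
    and occ: "is_occurrence (\<pi>, ({0,k} \<times> {0..k}) \<union> ({0..k} \<times> {0,k})) \<tau> ps"
begin

lemmas occD = is_occurrenceD[OF occ perms_length[OF \<pi>] perms_length[OF \<tau>]]

lemma occ_size_pos: "0 < n"
  using occD(1,3) k by (cases ps) auto

text \<open>Whatever its height, a point outside the occurrence lies in some row \<open>y\<close>.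
  In the leftmost or rightmost column its box \<open>(x, y)\<close> would be shaded for every
  \<open>y\<close>.\<close>

lemma boundary_shading_entry:
  assumes "x \<in> {0, k}" "m \<in> {1..n}" "m \<notin> set ps"
  shows "\<not> (occ_pos \<tau> ps x < m \<and> m < occ_pos \<tau> ps (Suc x))"
proof
  assume *: "occ_pos \<tau> ps x < m \<and> m < occ_pos \<tau> ps (Suc x)"
  \<comment> \<open>By injectivity of \<open>\<tau>\<close>, a position outside \<open>ps\<close>
    also has a value different from all values of the occurrence, so that value falls strictly
    between two neighbours.\<close>
  have "entry \<tau> m \<notin> set (sort (map (entry \<tau>) ps))"
    using perms_entry_inj[OF \<tau>] assms(2,3) occD(3) by (auto dest!: inj_onD)
  then obtain y where "y \<le> k" "occ_val \<tau> ps y < entry \<tau> m" "entry \<tau> m < occ_val \<tau> ps (Suc y)"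
    using sorted_list_gap[of "sort (map (entry \<tau>) ps)" 0 "entry \<tau> m" "n + 1"]
      perms_entry_range[OF \<tau> assms(2)] occD(1) perms_length[OF \<tau>]
    by (auto simp: occ_val_def)
  then show False using occD(5)[of x y m] * assms by auto
qed

text \<open>The transposed argument: some column \<open>x\<close> contains the point, and the bottom
  and top rows are shaded in every column.\<close>

lemma boundary_shading_value:
  assumes "y \<in> {0, k}" "m \<in> {1..n}" "m \<notin> set ps"
  shows "\<not> (occ_val \<tau> ps y < entry \<tau> m \<and> entry \<tau> m < occ_val \<tau> ps (Suc y))"
proof
  assume *: "occ_val \<tau> ps y < entry \<tau> m \<and> entry \<tau> m < occ_val \<tau> ps (Suc y)"
  obtain x where "x \<le> k" "occ_pos \<tau> ps x < m" "m < occ_pos \<tau> ps (Suc x)"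
    using sorted_list_gap[of ps 0 m "n + 1"] assms occD(1,2) perms_length[OF \<tau>]
    by (auto simp: occ_pos_def strict_sorted_iff)
  then show False using occD(5)[of x y m] * assms by auto
qed

text \<open>Otherwise position 1 precedes the whole occurrence, so its point lies in column 0,
  between \<open>0\<close> and \<open>ps ! 0\<close>.\<close>

lemma occ_first_position: "ps ! 0 = 1"
proof (rule ccontr)
  assume ne: "ps ! 0 \<noteq> 1"
  have le: "ps ! 0 \<le> p" if "p \<in> set ps" for p
    using that occD(2) by (cases ps) auto
  have "ps ! 0 \<in> set ps" using occD(1) k by auto
  then have "1 < ps ! 0" using ne occD(3) by force
  moreover from this have "1 \<notin> set ps" using le by fastforce
  ultimately show False
    using boundary_shading_entry[of 0 1] occ_size_pos occD(1) k
    by (auto simp: occ_pos_def nth_append)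
qed

text \<open>Otherwise position \<open>n\<close> follows the whole occurrence, so its point lies in
  column \<open>k\<close>, which ends at the padding value \<open>n + 1\<close>.\<close>

lemma occ_last_position: "ps ! (k - 1) = n"
proof (rule ccontr)
  assume ne: "ps ! (k - 1) \<noteq> n"
  have le: "p \<le> ps ! (k - 1)" if "p \<in> set ps" for p
  proof -
    obtain i where "i < k" "p = ps ! i" using \<open>p \<in> set ps\<close> occD(1) by (auto simp: in_set_conv_nth)
    then show ?thesis
      using occD(1,2) sorted_nth_mono[of ps i "k - 1"] by (auto simp: strict_sorted_iff)
  qed
  have "ps ! (k - 1) \<in> set ps" using occD(1) k by auto
  then have "ps ! (k - 1) < n" using ne occD(3) by force
  moreover from this have "n \<notin> set ps" using le by fastforce
  ultimately show False
    using boundary_shading_entry[of k n] occ_size_pos occD(1) k perms_length[OF \<tau>]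
    by (auto simp: occ_pos_def nth_append nth_Cons')
qed

lemma occ_values_range: "v \<in> set (sort (map (entry \<tau>) ps)) \<Longrightarrow> v \<in> {1..n}"
  using perms_entry_range[OF \<tau>] occD(3) by auto

lemma occ_min_value: "1 \<in> entry \<tau> ` set ps"
proof (rule ccontr)
  assume no: "1 \<notin> entry \<tau> ` set ps"
  obtain m where m: "m \<in> {1..n}" "entry \<tau> m = 1"
    using perms_entry_surj[OF \<tau>, of 1] occ_size_pos by auto
  then have "m \<notin> set ps" using no by (metis image_eqI)
  let ?vs = "sort (map (entry \<tau>) ps)"
  have "?vs ! 0 \<in> set ?vs" using occD(1) k by (intro nth_mem) simp
  \<comment> \<open>All values of the occurrence exceed 1, which places the point of value 1 in the
    bottom row.\<close>
  with no occ_values_range have "1 < ?vs ! 0"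
    by (metis atLeastAtMost_iff image_set le_neq_implies_less set_sort)
  then show False
    using boundary_shading_value[of 0 m] m \<open>m \<notin> set ps\<close> occD(1) k
    by (auto simp: occ_val_def nth_append)
qed

lemma occ_max_value: "n \<in> entry \<tau> ` set ps"
proof (rule ccontr)
  assume no: "n \<notin> entry \<tau> ` set ps"
  obtain m where m: "m \<in> {1..n}" "entry \<tau> m = n"
    using perms_entry_surj[OF \<tau>, of n] occ_size_pos by auto
  then have "m \<notin> set ps" using no by (metis image_eqI)
  let ?vs = "sort (map (entry \<tau>) ps)"
  have "?vs ! (k - 1) \<in> set ?vs" using occD(1) k by (intro nth_mem) simp
  \<comment> \<open>All values of the occurrence stay below \<open>n\<close>, which places the point
    of value \<open>n\<close> in the top row.\<close>
  with no occ_values_range have "?vs ! (k - 1) < n"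
    by (metis atLeastAtMost_iff image_set le_neq_implies_less set_sort)
  then show False
    using boundary_shading_value[of k m] m \<open>m \<notin> set ps\<close> occD(1) k perms_length[OF \<tau>]
    by (auto simp: occ_val_def nth_append nth_Cons')
qed

text \<open>The occurrence attains the value 1 at some \<open>ps ! b\<close>. No letter of
  \<open>\<pi>\<close> is below the letter 1 at \<open>Suc a\<close>, so by order isomorphism the
  value at \<open>ps ! a\<close> is at most the one at \<open>ps ! b\<close>.\<close>

lemma occ_min_transfer:
  assumes "a < k" "entry \<pi> (Suc a) = 1"
  shows "entry \<tau> (ps ! a) = 1"
proof -
  obtain b where b: "b < k" "entry \<tau> (ps ! b) = 1"
    using occ_min_value occD(1) by (auto simp: in_set_conv_nth)
  have "entry \<pi> (Suc b) \<ge> 1" using perms_entry_range[OF \<pi>, of "Suc b"] b by auto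
  then have "\<not> entry \<tau> (ps ! b) < entry \<tau> (ps ! a)" using occD(4)[OF b(1) assms(1)] assms by simp
  moreover have "entry \<tau> (ps ! a) \<ge> 1"
    using occ_values_range[of "entry \<tau> (ps ! a)"] occD(1) assms(1) by auto
  ultimately show ?thesis using b by simp
qed

lemma occ_max_transfer:
  assumes "a < k" "entry \<pi> (Suc a) = k"
  shows "entry \<tau> (ps ! a) = n"
proof -
  obtain b where b: "b < k" "entry \<tau> (ps ! b) = n"
    using occ_max_value occD(1) by (auto simp: in_set_conv_nth)
  have "entry \<pi> (Suc b) \<le> k" using perms_entry_range[OF \<pi>, of "Suc b"] b by auto
  then have "\<not> entry \<tau> (ps ! a) < entry \<tau> (ps ! b)" using occD(4)[OF assms(1) b(1)] assms by simp
  moreover have "entry \<tau> (ps ! a) \<le> n"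
    using occ_values_range[of "entry \<tau> (ps ! a)"] occD(1) assms(1) by auto
  ultimately show ?thesis using b by simp
qed

text \<open>The first and last letters of \<open>\<pi>\<close> are played by the first and last
  letters of \<open>\<tau>\<close>, and the extreme letters \<open>1\<close> and \<open>k\<close> by
  the extreme values \<open>1\<close> and \<open>n\<close>.\<close>

lemma occ_extremal_end:
  assumes "entry \<pi> 1 \<in> {1, k} \<or> entry \<pi> k \<in> {1, k}"
  shows "entry \<tau> 1 \<in> {1, n} \<or> entry \<tau> n \<in> {1, n}"
  using assms k occ_min_transfer[of 0] occ_max_transfer[of 0] occ_min_transfer[of "k - 1"]
    occ_max_transfer[of "k - 1"] occ_first_position occ_last_position
  by auto

end

section \<open>Counting and passage to the limit\<close>

text \<open>A union bound over four events: the letter at position \<open>1\<close> or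
  \<open>n\<close> equals \<open>1\<close> or \<open>n\<close>. Each event holds for at most
  \<open>fact (n - 1)\<close> permutations.\<close>

lemma s_plus_boundary_le:
  assumes "\<pi> \<in> perms k" "0 < k" "entry \<pi> 1 \<in> {1, k} \<or> entry \<pi> k \<in> {1, k}" "0 < n"
  shows "s_plus n (\<pi>, ({0,k} \<times> {0..k}) \<union> ({0..k} \<times> {0,k})) \<le> 4 * fact (n - 1)"
proof -
  let ?F = "\<lambda>m v. {\<tau> \<in> perms n. entry \<tau> m = v}"
  have fin: "finite (?F m v)" for m v by (simp add: perms_def)
  have "s_plus n (\<pi>, ({0,k} \<times> {0..k}) \<union> ({0..k} \<times> {0,k}))
      \<le> card ((?F 1 1 \<union> ?F 1 n) \<union> (?F n 1 \<union> ?F n n))"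
    unfolding s_plus_def contains_mesh_def
    using occ_extremal_end[OF assms(1) _ assms(2) _ assms(3)] fin
    by (intro card_mono) fastforce+
  also have "\<dots> \<le> (card (?F 1 1) + card (?F 1 n)) + (card (?F n 1) + card (?F n n))"
    by (meson add_mono card_Un_le order_trans)
  also have "\<dots> \<le> (fact (n - 1) + fact (n - 1)) + (fact (n - 1) + fact (n - 1))"
    using assms(4) by (intro add_mono card_perms_fixed_entry) auto
  finally show ?thesis by simp
qed

text \<open>If neither end letter is 1 or 4, the ends are 2 and 3 in some order and the middle
  letters are 1 and 4 in some order. These are precisely the four excluded permutations.\<close>

lemma perms_4_extremal_end:
  assumes "\<pi> \<in> perms 4 - {[2,1,4,3], [2,4,1,3], [3,1,4,2], [3,4,1,2]}"
  shows "entry \<pi> 1 \<in> {1, 4} \<or> entry \<pi> 4 \<in> {1, 4}"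
proof -
  have "length \<pi> = 4" using assms perms_length by auto
  then obtain a b c d where eq: "\<pi> = [a, b, c, d]"
    by (auto simp: numeral_eq_Suc length_Suc_conv)
  have S: "{1..4} = {1, 2, 3, 4 :: nat}" by auto
  have "set \<pi> = {1, 2, 3, 4}" "distinct \<pi>"
    using assms S by (auto simp: perms_def dest: permutations_of_setD)
  then have "distinct [a, b, c, d]" "a \<in> {1, 2, 3, 4}" "b \<in> {1, 2, 3, 4}" "c \<in> {1, 2, 3, 4}"
      "d \<in> {1, 2, 3, 4}"
    unfolding eq by auto
  then show ?thesis using assms by (auto simp: eq entry_def)
qed

theorem theorem4p2:
  fixes \<pi> :: "nat list" and R :: "(nat \<times> nat) set" and p :: mesh_pattern
  assumes "\<pi> \<in> perms 4 - {[2,1,4,3], [2,4,1,3], [3,1,4,2], [3,4,1,2]}"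
    and "R = ({0,4} \<times> {0..4}) \<union> ({0..4} \<times> {0,4})"
    and "p = (\<pi>, R)"
  shows "(\<lambda>n. real (s_plus n p) / fact n) \<longlonglongrightarrow> 0"
proof (rule tendsto_sandwich[where f = "\<lambda>_. 0" and h = "\<lambda>n. 4 / real n"])
  have "real (s_plus n p) / fact n \<le> 4 / real n" if "0 < n" for n
  proof -
    have "s_plus n p \<le> 4 * fact (n - 1)"
      using s_plus_boundary_le[of \<pi> 4 n] perms_4_extremal_end[OF assms(1)] assms that by simp
    then have "real (s_plus n p) \<le> 4 * fact (n - 1)"
      by (metis of_nat_fact of_nat_le_iff of_nat_mult of_nat_numeral)
    then have "real (s_plus n p) / fact n \<le> 4 * fact (n - 1) / fact n"
      by (intro divide_right_mono) auto
    \<comment> \<open>Cancels \<open>fact (n - 1)\<close> through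
      \<open>fact n = n * fact (n - 1)\<close>, which is where \<open>n\<close> must be
      positive.\<close>
    also have "\<dots> = 4 / real n" using that by (simp add: fact_reduce)
    finally show ?thesis .
  qed
  then show "\<forall>\<^sub>F n in sequentially. real (s_plus n p) / fact n \<le> 4 / real n"
    by (intro eventually_mono[OF eventually_gt_at_top[of 0]])
  show "(\<lambda>n. 4 / real n) \<longlonglongrightarrow> 0" by (rule lim_const_over_n)
qed auto

end
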